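(* Let $T\in\mathbb{B}(\mathcal{H})$ be a bounded linear operator on a complex Hilbert space $\mathcal{H}$ and let $\lambda\in[0,1]$. Then $$\|M_\lambda(T)\|^4\le \|Q_\lambda(T)\|^2+4(\lambda-\lambda^2)^2\,\omega^2(T^*T^D)+2(\lambda-\lambda^2)\,\omega\big(Q_\lambda(T)T^*T^D+T^*T^DQ_\lambda(T)\big),$$ where $Q_\lambda(T)=\lambda^2|T|^2+(1-\lambda)^2|T^D|^2$.
   Context: $\mathbb{B}(\mathcal{H})$ is the algebra of bounded linear operators on the complex Hilbert space $\mathcal{H}$, $\|\cdot\|$ the operator norm, $|A|=(A^*A)^{1/2}$, and $\omega(A)=\sup\{|\langle Ax,x\rangle|:\ x\in\mathcal{H},\ \|x\|=1\}$ is the numerical radius; $\omega^2(A)$ means $(\omega(A))^2$. $T=U|T|$ denotes the canonical polar decomposition, where $U$ is the unique partial isometry with $T=U|T|$ and $\mathcal{N}(U)=\mathcal{N}(T)$ (null spaces). The Duggal transform of $T$ is $T^D:=|T|U$. For $\lambda\in[0,1]$ the $\lambda$-mean transform of $T$ is $M_\lambda(T):=\lambda T+(1-\lambda)T^D$. *)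

theory Defs
  imports "HOL-Analysis.Analysis"
begin

text \<open>
  The distribution has only real inner product spaces. A complex inner product space is
  axiomatised here as a real one carrying a complex scalar multiplication and a sesquilinear
  form (linear in the first argument) whose real part is the given real inner product.
  Positive definiteness and \<open>norm x = sqrt (Re (cinner x x))\<close> are inherited from
  \<^class>\<open>real_inner\<close>.
\<close>

class complex_inner = real_inner +
  fixes scaleC :: "complex \<Rightarrow> 'a \<Rightarrow> 'a"  (infixr "*\<^sub>C" 75)
    and cinner :: "'a \<Rightarrow> 'a \<Rightarrow> complex"
  assumes scaleC_add_right: "c *\<^sub>C (x + y) = c *\<^sub>C x + c *\<^sub>C y"
    and scaleC_add_left: "(c + d) *\<^sub>C x = c *\<^sub>C x + d *\<^sub>C x"
    and scaleC_scaleC: "c *\<^sub>C (d *\<^sub>C x) = (c * d) *\<^sub>C x"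
    and scaleC_of_real: "complex_of_real r *\<^sub>C x = r *\<^sub>R x"
    and cinner_add_left: "cinner (x + y) z = cinner x z + cinner y z"
    and cinner_scaleC_left: "cinner (c *\<^sub>C x) y = c * cinner x y"
    and cinner_commute: "cinner x y = cnj (cinner y x)"
    and inner_eq_Re_cinner: "inner x y = Re (cinner x y)"

class chilbert_space = complex_inner + complete_space

instantiation complex :: chilbert_space
begin

definition scaleC_complex :: "complex \<Rightarrow> complex \<Rightarrow> complex" where
  "scaleC_complex c x = c * x"

definition cinner_complex :: "complex \<Rightarrow> complex \<Rightarrow> complex" where
  "cinner_complex x y = x * cnj y"

instance
  by standard
    (simp_all add: scaleC_complex_def cinner_complex_def algebra_simps inner_complex_def
      scaleR_conv_of_real)

end

text \<open>
  Elements of \<open>'a \<Rightarrow>\<^sub>L 'a\<close> are bounded real-linear maps, with the operator norm as norm; the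
  bounded operators on the complex space \<open>'a\<close> are those that satisfy \<open>complex_linear\<close>.
\<close>

definition complex_linear :: "('a::complex_inner \<Rightarrow>\<^sub>L 'a) \<Rightarrow> bool" where
  "complex_linear A \<longleftrightarrow> (\<forall>c x. blinfun_apply A (c *\<^sub>C x) = c *\<^sub>C blinfun_apply A x)"

definition op_adjoint :: "('a::complex_inner \<Rightarrow>\<^sub>L 'a) \<Rightarrow> ('a \<Rightarrow>\<^sub>L 'a)" where
  "op_adjoint A =
    (THE B. \<forall>x y. cinner (blinfun_apply A x) y = cinner x (blinfun_apply B y))"

definition positive_op :: "('a::complex_inner \<Rightarrow>\<^sub>L 'a) \<Rightarrow> bool" where
  "positive_op A \<longleftrightarrow> complex_linear A \<and>
    (\<forall>x. cinner (blinfun_apply A x) x \<in> \<real> \<and> 0 \<le> Re (cinner (blinfun_apply A x) x))"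

definition op_sqrt :: "('a::complex_inner \<Rightarrow>\<^sub>L 'a) \<Rightarrow> ('a \<Rightarrow>\<^sub>L 'a)" where
  "op_sqrt A = (THE B. positive_op B \<and> B o\<^sub>L B = A)"

definition op_abs :: "('a::complex_inner \<Rightarrow>\<^sub>L 'a) \<Rightarrow> ('a \<Rightarrow>\<^sub>L 'a)" where
  "op_abs A = op_sqrt (op_adjoint A o\<^sub>L A)"

definition null_space :: "('a::complex_inner \<Rightarrow>\<^sub>L 'a) \<Rightarrow> 'a set" where
  "null_space A = {x. blinfun_apply A x = 0}"

definition partial_isometry :: "('a::complex_inner \<Rightarrow>\<^sub>L 'a) \<Rightarrow> bool" where
  "partial_isometry U \<longleftrightarrow> complex_linear U \<and>
    (\<forall>x. (\<forall>y \<in> null_space U. cinner x y = 0) \<longrightarrow> norm (blinfun_apply U x) = norm x)"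

definition polar_isometry :: "('a::complex_inner \<Rightarrow>\<^sub>L 'a) \<Rightarrow> ('a \<Rightarrow>\<^sub>L 'a)" where
  "polar_isometry T =
    (THE U. partial_isometry U \<and> T = U o\<^sub>L op_abs T \<and> null_space U = null_space T)"

definition duggal_transform :: "('a::complex_inner \<Rightarrow>\<^sub>L 'a) \<Rightarrow> ('a \<Rightarrow>\<^sub>L 'a)" where
  "duggal_transform T = op_abs T o\<^sub>L polar_isometry T"

definition mean_transform :: "real \<Rightarrow> ('a::complex_inner \<Rightarrow>\<^sub>L 'a) \<Rightarrow> ('a \<Rightarrow>\<^sub>L 'a)" where
  "mean_transform l T = l *\<^sub>R T + (1 - l) *\<^sub>R duggal_transform T"

text \<open>
  The element 0 matters only on the zero space, which has no unit vectors; there it makes the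
  supremum 0, whereas the supremum of the empty set of reals is unspecified.
\<close>

definition numerical_radius :: "('a::complex_inner \<Rightarrow>\<^sub>L 'a) \<Rightarrow> real" where
  "numerical_radius A =
    Sup (insert 0 {cmod (cinner (blinfun_apply A x) x) | x. norm x = 1})"

definition Q_op :: "real \<Rightarrow> ('a::complex_inner \<Rightarrow>\<^sub>L 'a) \<Rightarrow> ('a \<Rightarrow>\<^sub>L 'a)" where
  "Q_op l T = l\<^sup>2 *\<^sub>R (op_abs T o\<^sub>L op_abs T) +
    (1 - l)\<^sup>2 *\<^sub>R (op_abs (duggal_transform T) o\<^sub>L op_abs (duggal_transform T))"

end

theory Submission
  imports Defs
begin

text \<open>
  With \<open>M\<close> the mean transform, \<open>S = T\<^sup>* T\<^sup>D\<close>, \<open>c = l - l\<^sup>2\<close> and \<open>H = S + S\<^sup>*\<close>, one has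
  \<open>M\<^sup>* M = Q + c H\<close>, so \<open>norm M ^ 4 \<le> norm ((Q + c H)\<^sup>2)\<close>. Expand the square and use the
  triangle inequality: \<open>H\<close> and \<open>Q H + H Q\<close> are twice the real parts of \<open>S\<close> and \<open>Q S + S Q\<close>, and
  the norm of a self-adjoint operator is its numerical radius. The Duggal transform enters only
  through being a bounded complex-linear operator, which rests on the existence and uniqueness of
  adjoints, positive square roots and the polar decomposition.
\<close>

instance chilbert_space \<subseteq> banach ..

section \<open>Orthogonal projection and adjoints\<close>

text \<open>The point \<open>v\<close> minimises the distance from \<open>x\<close> to
  \<open>V\<close>. It is found as the common point of the closed nested sets \<open>S n\<close> of
  near-minimisers, whose diameters shrink to 0; minimality against the competitors
  \<open>v + t w\<close> then gives orthogonality.\<close>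

lemma closed_subspace_projection:
  fixes V :: "'a::{real_inner,complete_space} set"
  assumes "closed V" "subspace V"
  obtains v where "v \<in> V" "\<And>w. w \<in> V \<Longrightarrow> inner (x - v) w = 0"
proof -
  define d where "d = (INF v\<in>V. (norm (x - v))\<^sup>2)"
  define S where "S n = {v \<in> V. (norm (x - v))\<^sup>2 \<le> d + 1 / real (Suc n)}" for n
  have bdd: "bdd_below ((\<lambda>v. (norm (x - v))\<^sup>2) ` V)"
    by (auto intro: bdd_belowI[of _ 0])
  have d_le: "d \<le> (norm (x - v))\<^sup>2" if "v \<in> V" for v
    unfolding d_def using bdd that by (rule cINF_lower)
  have "\<exists>a. \<Inter>(range S) = {a}"
  proof (rule decreasing_closed_nest_sing)
    fix n
    have "closed {v. (norm (x - v))\<^sup>2 \<le> d + 1 / real (Suc n)}"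
      by (intro closed_Collect_le continuous_intros)
    moreover have "S n = V \<inter> {v. (norm (x - v))\<^sup>2 \<le> d + 1 / real (Suc n)}"
      by (auto simp: S_def)
    ultimately show "closed (S n)"
      using assms(1) by auto
    have "\<exists>v\<in>V. (norm (x - v))\<^sup>2 < d + 1 / real (Suc n)"
      using cINF_less_iff[OF _ bdd, of "d + 1 / real (Suc n)"] subspace_0[OF assms(2)]
      unfolding d_def by auto
    then show "S n \<noteq> {}"
      by (force simp: S_def)
  next
    fix m n :: nat
    assume "m \<le> n"
    then have "1 / real (Suc n) \<le> 1 / real (Suc m)"
      by (simp add: field_simps)
    then show "S n \<subseteq> S m"
      by (auto simp: S_def)
  next
    fix e :: real
    assume "0 < e"
    then obtain n where n: "4 / e\<^sup>2 < real n"
      using reals_Archimedean2 by blast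
    have "dist v w < e" if "v \<in> S n" "w \<in> S n" for v w
    proof -
      define m where "m = (1/2) *\<^sub>R (v + w)"
      have "m \<in> V"
        using that assms(2) by (simp add: m_def S_def subspace_add subspace_scale)
      \<comment> \<open>Parallelogram law. The midpoint \<open>m\<close> lies in \<open>V\<close>,
        so its squared distance to \<open>x\<close> is at least \<open>d\<close>, and what remains
        is at most 4 / (n + 1).\<close>
      moreover have "(dist v w)\<^sup>2 = 2 * (norm (x - v))\<^sup>2 + 2 * (norm (x - w))\<^sup>2 - 4 * (norm (x - m))\<^sup>2"
        by (simp add: m_def dist_norm power2_norm_eq_inner inner_diff_left inner_diff_right
            inner_add_left inner_add_right inner_commute algebra_simps)
      ultimately have "(dist v w)\<^sup>2 \<le> 4 / real (Suc n)"
        using that d_le[of m] by (auto simp: S_def)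
      also have "\<dots> < e\<^sup>2"
      proof -
        have "4 < real n * e\<^sup>2"
          using n \<open>0 < e\<close> by (simp add: field_simps)
        also have "\<dots> \<le> real (Suc n) * e\<^sup>2"
          by (intro mult_right_mono) simp_all
        finally show ?thesis
          by (simp add: pos_divide_less_eq mult.commute)
      qed
      finally show ?thesis
        using \<open>0 < e\<close> by (simp add: power2_less_imp_less)
    qed
    then show "\<exists>n. \<forall>v\<in>S n. \<forall>w\<in>S n. dist v w < e"
      by blast
  qed
  then obtain v where v: "v \<in> S n" for n
    by blast
  have vV: "v \<in> V"
    using v[of 0] by (simp add: S_def)
  have "(norm (x - v))\<^sup>2 - d \<le> inverse (real (Suc n))" for n
    using v[of n] by (simp add: S_def field_simps)
  then have "(norm (x - v))\<^sup>2 - d \<le> 0"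
    by (intro LIMSEQ_le_const[OF LIMSEQ_inverse_real_of_nat]) blast
  then have le: "(norm (x - v))\<^sup>2 \<le> (norm (x - w))\<^sup>2" if "w \<in> V" for w
    using d_le[OF that] by linarith
  have "inner (x - v) w = 0" if w: "w \<in> V" for w
  proof (cases "w = 0")
    case False
    \<comment> \<open>This \<open>t\<close> minimises the distance from \<open>x\<close> to the line
      through \<open>v\<close> in direction \<open>w\<close>.\<close>
    define t where "t = inner (x - v) w / inner w w"
    have "v + t *\<^sub>R w \<in> V"
      using vV w assms(2) by (simp add: subspace_add subspace_scale)
    from le[OF this] have "0 \<le> t * t * inner w w - 2 * t * inner (x - v) w"
      by (simp add: power2_norm_eq_inner inner_diff_left inner_diff_right
            inner_add_left inner_add_right inner_commute algebra_simps)
    also have "\<dots> = - ((inner (x - v) w)\<^sup>2 / inner w w)"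
      using False by (simp add: t_def field_simps power2_eq_square)
    finally have "(inner (x - v) w)\<^sup>2 / inner w w \<le> 0"
      by simp
    then show ?thesis
      using False by (simp add: divide_le_0_iff) (metis inner_gt_zero_iff not_less)
  qed simp
  with vV show ?thesis
    by (rule that)
qed

text \<open>The projection onto the closure of the range of \<open>B\<close> comes with an
  approximating sequence of preimages, because the polar isometry is later obtained by following
  another operator along that sequence.\<close>

lemma closed_range_projection:
  fixes B :: "'a::real_normed_vector \<Rightarrow>\<^sub>L 'b::{real_inner,complete_space}"
  obtains z v where "(\<lambda>n. B (z n)) \<longlonglongrightarrow> v" "\<And>y. inner (x - v) (B y) = 0"
proof -
  let ?V = "closure (range (blinfun_apply B))"
  have in_V: "v \<in> ?V \<longleftrightarrow> (\<exists>z. (\<lambda>n. B (z n)) \<longlonglongrightarrow> v)" for v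
  proof
    assume "v \<in> ?V"
    then obtain b where "\<forall>n. b n \<in> range (blinfun_apply B)" and b: "b \<longlonglongrightarrow> v"
      using closure_sequential[of v "range (blinfun_apply B)"] by metis
    then have "\<forall>n. \<exists>z. b n = B z"
      by (simp add: image_iff)
    then obtain z where "\<forall>n. b n = B (z n)"
      by (rule choice[THEN exE])
    then have "b = (\<lambda>n. B (z n))"
      by (simp add: fun_eq_iff)
    with b show "\<exists>z. (\<lambda>n. B (z n)) \<longlonglongrightarrow> v"
      by blast
  next
    assume "\<exists>z. (\<lambda>n. B (z n)) \<longlonglongrightarrow> v"
    then obtain z where "(\<lambda>n. B (z n)) \<longlonglongrightarrow> v"
      by (rule exE)
    then show "v \<in> ?V"
      unfolding closure_sequential by (intro exI[of _ "\<lambda>n. B (z n)"]) simp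
  qed
  have "subspace ?V"
  proof (rule subspaceI)
    have "B 0 \<in> ?V"
      by (rule subsetD[OF closure_subset rangeI])
    then show "0 \<in> ?V"
      by (simp add: blinfun.zero_right)
    show "u + v \<in> ?V" if uv: "u \<in> ?V" "v \<in> ?V" for u v
    proof -
      obtain y z where "(\<lambda>n. B (y n)) \<longlonglongrightarrow> u" "(\<lambda>n. B (z n)) \<longlonglongrightarrow> v"
        using uv in_V by blast
      then have "(\<lambda>n. B (y n + z n)) \<longlonglongrightarrow> u + v"
        unfolding blinfun.add_right by (rule tendsto_add)
      then show ?thesis
        unfolding in_V by (rule exI[of _ "\<lambda>n. y n + z n"])
    qed
    show "c *\<^sub>R v \<in> ?V" if "v \<in> ?V" for c v
    proof -
      obtain z where "(\<lambda>n. B (z n)) \<longlonglongrightarrow> v"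
        using \<open>v \<in> ?V\<close> in_V by blast
      then have "(\<lambda>n. B (c *\<^sub>R z n)) \<longlonglongrightarrow> c *\<^sub>R v"
        unfolding blinfun.scaleR_right by (intro tendsto_scaleR tendsto_const)
      then show ?thesis
        unfolding in_V by (rule exI[of _ "\<lambda>n. c *\<^sub>R z n"])
    qed
  qed
  then obtain v where v: "v \<in> ?V" "\<And>w. w \<in> ?V \<Longrightarrow> inner (x - v) w = 0"
    using closed_subspace_projection[OF closed_closure] by metis
  moreover have "inner (x - v) (B y) = 0" for y
    by (intro v(2) subsetD[OF closure_subset rangeI])
  ultimately show ?thesis
    using that in_V by blast
qed

section \<open>Riesz representation and adjoints for the real inner product\<close>

lemma Riesz_representation:
  fixes f :: "'a::{real_inner,complete_space} \<Rightarrow> real"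
  assumes "bounded_linear f"
  obtains z where "\<And>x. f x = inner x z"
proof (cases "\<forall>x. f x = 0")
  case True
  then show ?thesis
    using that[of 0] by simp
next
  case False
  interpret f: bounded_linear f by fact
  obtain x0 where x0: "f x0 \<noteq> 0"
    using False by blast
  have "closed {x. f x = 0}"
    by (intro closed_Collect_eq continuous_intros f.continuous_on)
  moreover have "subspace {x. f x = 0}"
    by (simp add: subspace_def f.add f.scaleR)
  ultimately obtain v where v: "f v = 0" "\<And>w. f w = 0 \<Longrightarrow> inner (x0 - v) w = 0"
    using closed_subspace_projection[of "{x. f x = 0}" x0] by auto
  \<comment> \<open>The kernel of \<open>f\<close> has codimension one, and \<open>u\<close> spans
    its orthogonal complement; the representing vector is therefore a multiple of
    \<open>u\<close>.\<close>
  define u where "u = x0 - v"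
  have fu: "f u \<noteq> 0" "u \<noteq> 0"
    using x0 v(1) by (auto simp: u_def f.diff)
  have "f x = inner x ((f u / inner u u) *\<^sub>R u)" for x
  proof -
    \<comment> \<open>Subtracting this multiple of \<open>u\<close> moves \<open>x\<close> into the
      kernel.\<close>
    have "inner u (x - (f x / f u) *\<^sub>R u) = 0"
      unfolding u_def using fu(1) by (intro v(2)) (simp add: f.diff f.scaleR u_def v(1) x0)
    then show ?thesis
      using fu by (simp add: inner_diff_right inner_commute field_simps)
  qed
  then show ?thesis
    by (rule that)
qed

lemma real_adjoint_exists:
  fixes A :: "'a::{real_inner,complete_space} \<Rightarrow>\<^sub>L 'b::real_inner"
  obtains B where "\<And>x y. inner (blinfun_apply A x) y = inner x (blinfun_apply B y)"
proof -
  have "\<exists>z. \<forall>x. inner (A x) y = inner x z" for y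
  proof -
    have "bounded_linear (\<lambda>x. inner (A x) y)"
      by (intro bounded_linear_intros)
    then show ?thesis
      by (metis Riesz_representation)
  qed
  then obtain g where g: "\<And>x y. inner (A x) y = inner x (g y)"
    by metis
  have "bounded_linear g"
  proof (rule bounded_linear_intro)
    show "g (x + y) = g x + g y" for x y
      by (rule vector_eq_ldot[THEN iffD1]) (simp add: inner_add_right flip: g)
    show "g (r *\<^sub>R x) = r *\<^sub>R g x" for r x
      by (rule vector_eq_ldot[THEN iffD1]) (simp flip: g)
    fix y
    \<comment> \<open>Testing the adjoint relation at \<open>g y\<close> itself bounds
      \<open>g\<close> by the norm of \<open>A\<close>.\<close>
    have "norm (g y) * norm (g y) = inner (A (g y)) y"
      by (simp add: g norm_eq_sqrt_inner)
    also have "\<dots> \<le> norm (A (g y)) * norm y"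
      by (rule norm_cauchy_schwarz)
    also have "\<dots> \<le> norm A * norm (g y) * norm y"
      by (intro mult_right_mono norm_blinfun) simp
    finally show "norm (g y) \<le> norm y * norm A"
      by (cases "norm (g y) = 0") (auto simp: mult_ac)
  qed
  then show ?thesis
    using that[of "Blinfun g"] g by (simp add: bounded_linear_Blinfun_apply)
qed

section \<open>Complex-linear and self-adjoint operators\<close>

lemma cinner_scaleC_right: "cinner x (c *\<^sub>C y) = cnj c * cinner x y"
  by (metis cinner_commute cinner_scaleC_left complex_cnj_mult)

text \<open>Multiplication by -i turns the imaginary part into a real part, so the real inner
  product determines the whole complex form.\<close>

lemma Im_cinner: "Im (cinner x y) = inner ((- \<i>) *\<^sub>C x) y"
  by (simp add: inner_eq_Re_cinner cinner_scaleC_left)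

lemma inner_scaleC: "inner (c *\<^sub>C x) y = inner x (cnj c *\<^sub>C y)"
  by (simp add: inner_eq_Re_cinner cinner_scaleC_left cinner_scaleC_right)

lemma norm_scaleC: "norm (c *\<^sub>C x) = cmod c * norm x"
proof -
  have cnj: "cnj c * c = complex_of_real ((cmod c)\<^sup>2)"
    by (simp add: complex_norm_square mult.commute del: of_real_power)
  have "inner (c *\<^sub>C x) (c *\<^sub>C x) = (cmod c)\<^sup>2 * inner x x"
    by (simp add: inner_scaleC scaleC_scaleC cnj scaleC_of_real del: of_real_power)
  then show ?thesis
    by (simp add: norm_eq_sqrt_inner real_sqrt_mult)
qed

lemma bounded_linear_scaleC: "bounded_linear (\<lambda>x. c *\<^sub>C x)"
proof (rule bounded_linear_intro)
  show "c *\<^sub>C (r *\<^sub>R x) = r *\<^sub>R c *\<^sub>C x" for r x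
    by (simp add: scaleC_scaleC mult.commute flip: scaleC_of_real)
  show "norm (c *\<^sub>C x) \<le> norm x * cmod c" for x
    by (simp add: norm_scaleC)
qed (rule scaleC_add_right)

lemmas scaleC_diff_right = linear_diff[OF bounded_linear.linear[OF bounded_linear_scaleC]]
  and scaleC_scaleR = linear_scale[OF bounded_linear.linear[OF bounded_linear_scaleC]]
  and scaleC_zero_right = linear_0[OF bounded_linear.linear[OF bounded_linear_scaleC]]
  and tendsto_scaleC = bounded_linear.tendsto[OF bounded_linear_scaleC]

text \<open>Rotating \<open>x\<close> by a complex number of modulus one makes the form real and
  nonnegative, which reduces the claim to the real Cauchy-Schwarz inequality.\<close>

lemma cmod_cinner_le: "cmod (cinner x y) \<le> norm x * norm y"
proof (cases "cinner x y = 0")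
  case False
  define c where "c = cnj (cinner x y) / cmod (cinner x y)"
  have "cmod c = 1"
    using False by (simp add: c_def norm_divide)
  have "c * cinner x y = cmod (cinner x y)"
    using False by (simp add: c_def field_simps power2_eq_square flip: complex_norm_square)
  then have "cmod (cinner x y) = inner (c *\<^sub>C x) y"
    by (simp add: inner_eq_Re_cinner cinner_scaleC_left)
  also have "\<dots> \<le> norm (c *\<^sub>C x) * norm y"
    by (rule norm_cauchy_schwarz)
  finally show ?thesis
    by (simp add: norm_scaleC \<open>cmod c = 1\<close>)
qed simp

lemma complex_linearD: "complex_linear A \<Longrightarrow> A (c *\<^sub>C x) = c *\<^sub>C A x"
  by (simp add: complex_linear_def)

lemma complex_linear_intros:
  "complex_linear 0"
  "complex_linear id_blinfun"
  "complex_linear A \<Longrightarrow> complex_linear B \<Longrightarrow> complex_linear (A + B)"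
  "complex_linear A \<Longrightarrow> complex_linear B \<Longrightarrow> complex_linear (A - B)"
  "complex_linear A \<Longrightarrow> complex_linear (r *\<^sub>R A)"
  "complex_linear A \<Longrightarrow> complex_linear B \<Longrightarrow> complex_linear (A o\<^sub>L B)"
  by (simp_all add: complex_linear_def blinfun.bilinear_simps scaleC_add_right
      scaleC_diff_right scaleC_scaleR scaleC_zero_right)

lemma complex_linear_lim:
  assumes "F \<longlonglongrightarrow> A" "\<And>n. complex_linear (F n)"
  shows "complex_linear A"
  unfolding complex_linear_def
proof (intro allI)
  fix c x
  have "(\<lambda>n. F n (c *\<^sub>C x)) \<longlonglongrightarrow> A (c *\<^sub>C x)"
    by (intro tendsto_intros assms)
  moreover have "(\<lambda>n. c *\<^sub>C F n x) \<longlonglongrightarrow> c *\<^sub>C A x"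
    by (intro tendsto_scaleC tendsto_intros assms)
  ultimately show "A (c *\<^sub>C x) = c *\<^sub>C A x"
    using assms(2) by (simp add: complex_linearD LIMSEQ_unique)
qed

text \<open>The real relation at -i \<open>x\<close> supplies the imaginary part of the complex one,
  since \<open>A\<close> commutes with that scalar. Adjoints can thus be handled through the real
  inner product throughout.\<close>

lemma cinner_adjoint_iff:
  assumes "complex_linear A"
  shows "(\<forall>x y. cinner (A x) y = cinner x (B y)) \<longleftrightarrow> (\<forall>x y. inner (A x) y = inner x (B y))"
proof
  assume *: "\<forall>x y. inner (A x) y = inner x (B y)"
  have "Im (cinner (A x) y) = Im (cinner x (B y))" for x y
    using * complex_linearD[OF assms] by (simp add: Im_cinner) metis
  moreover have "Re (cinner (A x) y) = Re (cinner x (B y))" for x y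
    using * by (simp flip: inner_eq_Re_cinner)
  ultimately show "\<forall>x y. cinner (A x) y = cinner x (B y)"
    by (simp add: complex_eq_iff)
qed (simp add: inner_eq_Re_cinner)

text \<open>The definite description in \<open>op_adjoint\<close> is resolved by the real adjoint,
  which is unique because inner products separate points.\<close>

lemma inner_op_adjoint:
  fixes A :: "'a::chilbert_space \<Rightarrow>\<^sub>L 'a"
  assumes "complex_linear A"
  shows "inner (A x) y = inner x (op_adjoint A y)"
proof -
  obtain B where B: "\<And>x y. inner (A x) y = inner x (blinfun_apply B y)"
    using real_adjoint_exists[of A] by blast
  have "op_adjoint A = B"
    unfolding op_adjoint_def cinner_adjoint_iff[OF assms]
  proof (rule the_equality)
    show "C = B" if "\<forall>x y. inner (A x) y = inner x (blinfun_apply C y)" for C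
      using that by (intro blinfun_eqI vector_eq_ldot[THEN iffD1]) (simp add: B)
  qed (simp add: B)
  with B show ?thesis
    by simp
qed

text \<open>A scalar crosses the inner product as its conjugate, passes through \<open>A\<close>,
  and crosses back unchanged.\<close>

lemma complex_linear_adjoint:
  assumes "complex_linear A" "\<And>x y. inner (A x) y = inner x (blinfun_apply B y)"
  shows "complex_linear B"
  unfolding complex_linear_def
proof (intro allI)
  fix c x
  show "B (c *\<^sub>C x) = c *\<^sub>C B x"
  proof (rule vector_eq_ldot[THEN iffD1], rule allI)
    fix y
    have "inner y (c *\<^sub>C B x) = inner (cnj c *\<^sub>C y) (B x)"
      by (simp add: inner_scaleC)
    also have "\<dots> = inner (A y) (c *\<^sub>C x)"
      by (simp add: complex_linearD[OF assms(1)] inner_scaleC flip: assms(2))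
    finally show "inner y (B (c *\<^sub>C x)) = inner y (c *\<^sub>C B x)"
      by (simp add: assms(2))
  qed
qed

text \<open>Symmetry is phrased with the real inner product; for complex-linear operators
  \<open>cinner_adjoint_iff\<close> makes this the usual complex notion.\<close>

definition selfadjoint :: "('a::real_inner \<Rightarrow>\<^sub>L 'a) \<Rightarrow> bool" where
  "selfadjoint A \<longleftrightarrow> (\<forall>x y. inner (A x) y = inner x (A y))"

lemma selfadjointD: "selfadjoint A \<Longrightarrow> inner (A x) y = inner x (A y)"
  by (simp add: selfadjoint_def)

lemma selfadjoint_intros:
  "selfadjoint 0"
  "selfadjoint id_blinfun"
  "selfadjoint A \<Longrightarrow> selfadjoint B \<Longrightarrow> selfadjoint (A + B)"
  "selfadjoint A \<Longrightarrow> selfadjoint B \<Longrightarrow> selfadjoint (A - B)"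
  "selfadjoint A \<Longrightarrow> selfadjoint (r *\<^sub>R A)"
  "selfadjoint A \<Longrightarrow> selfadjoint (A o\<^sub>L A)"
  by (simp_all add: selfadjoint_def blinfun.bilinear_simps inner_add_left inner_add_right
      inner_diff_left inner_diff_right)

lemma selfadjoint_lim:
  assumes "F \<longlonglongrightarrow> A" "\<And>n. selfadjoint (F n)"
  shows "selfadjoint A"
  unfolding selfadjoint_def
proof (intro allI)
  fix x y
  have "(\<lambda>n. inner (F n x) y) \<longlonglongrightarrow> inner (A x) y"
    by (intro tendsto_intros assms)
  moreover have "(\<lambda>n. inner x (F n y)) \<longlonglongrightarrow> inner x (A y)"
    by (intro tendsto_intros assms)
  ultimately show "inner (A x) y = inner x (A y)"
    using assms(2) by (simp add: selfadjointD LIMSEQ_unique)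
qed

text \<open>Polarisation expresses \<open>inner (A x) y\<close> through the quadratic form at
  \<open>x + y\<close> and \<open>x - y\<close>, and the parallelogram law bounds the result;
  choosing \<open>y\<close> along \<open>A x\<close> gives the norm.\<close>

lemma norm_selfadjoint_le:
  assumes "selfadjoint A" and le: "\<And>x. \<bar>inner (A x) x\<bar> \<le> r * (norm x)\<^sup>2" and "0 \<le> r"
  shows "norm A \<le> r"
proof (rule norm_blinfun_bound)
  fix x
  have polar: "inner (A x) y \<le> r / 2 * ((norm x)\<^sup>2 + (norm y)\<^sup>2)" for y
  proof -
    have "4 * inner (A x) y = inner (A (x + y)) (x + y) - inner (A (x - y)) (x - y)"
      using selfadjointD[OF assms(1), of x y]
      by (simp add: blinfun.bilinear_simps inner_add_left inner_add_right
          inner_diff_left inner_diff_right inner_commute)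
    also have "\<dots> \<le> r * (norm (x + y))\<^sup>2 + r * (norm (x - y))\<^sup>2"
      using le[of "x + y"] le[of "x - y"] by linarith
    also have "\<dots> = 2 * r * ((norm x)\<^sup>2 + (norm y)\<^sup>2)"
      by (simp add: power2_norm_eq_inner inner_add_left inner_add_right
          inner_diff_left inner_diff_right algebra_simps)
    finally show ?thesis
      by simp
  qed
  show "norm (A x) \<le> r * norm x"
  proof (cases "A x = 0")
    case False
    then have "x \<noteq> 0"
      by (auto simp: blinfun.bilinear_simps)
    \<comment> \<open>This scale gives \<open>t *\<^sub>R A x\<close> the norm of \<open>x\<close>,
      which balances the two squares in \<open>polar\<close>.\<close>
    define t where "t = norm x / norm (A x)"
    have "inner (A x) (t *\<^sub>R A x) \<le> r / 2 * ((norm x)\<^sup>2 + (norm (t *\<^sub>R A x))\<^sup>2)"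
      by (rule polar)
    moreover have "inner (A x) (t *\<^sub>R A x) = norm x * norm (A x)"
      using False by (simp add: t_def power2_eq_square flip: power2_norm_eq_inner)
    moreover have "norm (t *\<^sub>R A x) = norm x"
      using False by (simp add: t_def)
    ultimately have "norm x * norm (A x) \<le> r / 2 * ((norm x)\<^sup>2 + (norm x)\<^sup>2)"
      by (simp only:)
    then have "norm x * norm (A x) \<le> norm x * (r * norm x)"
      by (simp add: power2_eq_square mult_ac)
    then show ?thesis
      using \<open>x \<noteq> 0\<close> by simp
  qed (simp add: assms(3))
qed fact

lemma positive_op_iff:
  "positive_op A \<longleftrightarrow> complex_linear A \<and> selfadjoint A \<and> (\<forall>x. 0 \<le> inner (A x) x)"
proof
  assume A: "positive_op A"
  then have lin: "complex_linear A" and nonneg: "\<forall>x. 0 \<le> inner (A x) x"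
    by (simp_all add: positive_op_def inner_eq_Re_cinner)
  have real: "Im (cinner (A x) x) = 0" for x
    using A by (simp add: positive_op_def complex_is_Real_iff)
  have add_right: "cinner x (y + z) = cinner x y + cinner x z" for x y z :: 'a
    by (metis cinner_add_left cinner_commute complex_cnj_add)
  \<comment> \<open>The form at x + i y has imaginary part 0. Its diagonal terms are real, so the
    cross terms force Re<Ay, x> = Re<Ax, y>.\<close>
  have "inner (A x) y = inner (A y) x" for x y
    using real[of "x + \<i> *\<^sub>C y"] real[of x] real[of y]
    by (simp add: blinfun.bilinear_simps complex_linearD[OF lin] cinner_add_left add_right
        cinner_scaleC_left cinner_scaleC_right inner_eq_Re_cinner)
  with lin nonneg show "complex_linear A \<and> selfadjoint A \<and> (\<forall>x. 0 \<le> inner (A x) x)"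
    by (metis selfadjoint_def inner_commute)
next
  assume A: "complex_linear A \<and> selfadjoint A \<and> (\<forall>x. 0 \<le> inner (A x) x)"
  then have "cinner (A x) x = cinner x (A x)" for x
    using cinner_adjoint_iff[of A A] by (simp add: selfadjoint_def)
  then have "cinner (A x) x \<in> \<real>" for x
    by (metis Reals_cnj_iff cinner_commute)
  with A show "positive_op A"
    by (simp add: positive_op_def inner_eq_Re_cinner)
qed

section \<open>Positive square roots\<close>

text \<open>
  The iteration \<open>Y \<mapsto> (X + Y\<^sup>2) / 2\<close> has fixed point \<open>1 - sqrt (1 - X)\<close>. When \<open>norm X \<le> 1\<close>, its
  increments are dominated by those of the scalar iteration with \<open>X = 1\<close>, which is monotone and
  bounded; so it converges in norm.
\<close>

primrec sqrt_iter :: "('a::real_normed_vector \<Rightarrow>\<^sub>L 'a) \<Rightarrow> nat \<Rightarrow> ('a \<Rightarrow>\<^sub>L 'a)" where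
  "sqrt_iter X 0 = 0"
| "sqrt_iter X (Suc n) = (1/2) *\<^sub>R (X + (sqrt_iter X n o\<^sub>L sqrt_iter X n))"

primrec scalar_iter :: "nat \<Rightarrow> real" where
  "scalar_iter 0 = 0"
| "scalar_iter (Suc n) = (1 + scalar_iter n * scalar_iter n) / 2"

lemma scalar_iter_bounds: "0 \<le> scalar_iter n" "scalar_iter n \<le> 1"
proof (induction n)
  case (Suc n)
  then have "scalar_iter n * scalar_iter n \<le> 1"
    by (simp add: mult_le_one)
  with Suc show "0 \<le> scalar_iter (Suc n)" "scalar_iter (Suc n) \<le> 1"
    by simp_all
qed auto

lemma scalar_iter_convergent: "convergent scalar_iter"
proof (rule Bseq_mono_convergent)
  show "Bseq scalar_iter"
    using scalar_iter_bounds by (intro BseqI'[of _ 1]) simp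
  \<comment> \<open>The increment from a value s is (1 - s)^2 / 2.\<close>
  have "scalar_iter n \<le> scalar_iter (Suc n)" for n
    using zero_le_square[of "1 - scalar_iter n"] by (simp add: algebra_simps)
  then show "\<forall>m n. m \<le> n \<longrightarrow> scalar_iter m \<le> scalar_iter n"
    by (simp add: lift_Suc_mono_le)
qed

text \<open>This has two uses: iterates commute with one another, so differences of their squares
  factor; and in the limit the square root commutes with everything that commutes with the given
  operator.\<close>

lemma sqrt_iter_commute:
  assumes "C o\<^sub>L X = X o\<^sub>L C"
  shows "C o\<^sub>L sqrt_iter X n = sqrt_iter X n o\<^sub>L C"
proof (induction n)
  case (Suc n)
  have "C (X x) = X (C x)" "C (sqrt_iter X n x) = sqrt_iter X n (C x)" for x
    using assms Suc by (metis blinfun_apply_blinfun_compose)+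
  then show ?case
    by (intro blinfun_eqI) (simp add: blinfun.bilinear_simps)
qed (intro blinfun_eqI, simp add: blinfun.bilinear_simps)

lemma sqrt_iter_commute_self:
  "sqrt_iter X m o\<^sub>L sqrt_iter X n = sqrt_iter X n o\<^sub>L sqrt_iter X m"
  by (intro sqrt_iter_commute sqrt_iter_commute[symmetric] refl)

lemma norm_sqrt_iter_le:
  assumes "norm X \<le> 1"
  shows "norm (sqrt_iter X n) \<le> scalar_iter n"
proof (induction n)
  case (Suc n)
  have "norm (sqrt_iter X n o\<^sub>L sqrt_iter X n) \<le> norm (sqrt_iter X n) * norm (sqrt_iter X n)"
    by (rule norm_blinfun_compose)
  also have "\<dots> \<le> scalar_iter n * scalar_iter n"
    by (intro mult_mono Suc scalar_iter_bounds norm_ge_zero)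
  finally show ?case
    using norm_triangle_ineq[of X "sqrt_iter X n o\<^sub>L sqrt_iter X n"] assms by simp
qed simp

lemma norm_sqrt_iter_diff_le:
  assumes "norm X \<le> 1"
  shows "norm (sqrt_iter X (Suc n) - sqrt_iter X n) \<le> scalar_iter (Suc n) - scalar_iter n"
proof (induction n)
  case (Suc n)
  let ?Y = "sqrt_iter X" and ?y = "scalar_iter"
  have comm: "?Y (Suc n) (?Y n x) = ?Y n (?Y (Suc n) x)" for x
    using sqrt_iter_commute_self[of X "Suc n" n] by (metis blinfun_apply_blinfun_compose)
  have "?Y (Suc (Suc n)) - ?Y (Suc n)
      = (1/2) *\<^sub>R ((?Y (Suc n) + ?Y n) o\<^sub>L (?Y (Suc n) - ?Y n))" (is "_ = _ *\<^sub>R ?Z")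
    \<comment> \<open>Only the two outer iteration steps are unfolded: \<open>arg_cong\<close>
      restricts the second equation to the subtrahend, so \<open>?Y (Suc n)\<close> survives inside
      the factors.\<close>
    unfolding sqrt_iter.simps(2)[of X "Suc n"] sqrt_iter.simps(2)[of X n, THEN arg_cong, of "\<lambda>A. _ - A"]
    by (intro blinfun_eqI) (simp add: blinfun.bilinear_simps comm algebra_simps del: sqrt_iter.simps)
  moreover have "norm ?Z \<le> norm (?Y (Suc n) + ?Y n) * norm (?Y (Suc n) - ?Y n)"
    by (rule norm_blinfun_compose)
  moreover have "\<dots> \<le> (?y (Suc n) + ?y n) * (?y (Suc n) - ?y n)"
    using norm_sqrt_iter_le[OF assms] scalar_iter_bounds(1) Suc
    by (intro mult_mono norm_triangle_le add_mono) (auto simp del: sqrt_iter.simps scalar_iter.simps)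
  moreover have "\<dots> = 2 * (?y (Suc (Suc n)) - ?y (Suc n))"
    unfolding scalar_iter.simps(2)[of "Suc n"] scalar_iter.simps(2)[of n, THEN arg_cong, of "\<lambda>a. _ - a"]
    by (simp add: algebra_simps del: scalar_iter.simps)
  ultimately show ?case
    by (simp del: sqrt_iter.simps scalar_iter.simps)
qed (use assms in simp)

lemma sqrt_iter_convergent:
  fixes X :: "'a::banach \<Rightarrow>\<^sub>L 'a"
  assumes "norm X \<le> 1"
  shows "convergent (sqrt_iter X)"
proof -
  have "summable (\<lambda>n. scalar_iter (Suc n) - scalar_iter n)"
    using scalar_iter_convergent by (auto simp: convergent_def simp del: scalar_iter.simps intro: telescope_summable)
  then have "summable (\<lambda>n. sqrt_iter X (Suc n) - sqrt_iter X n)"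
    by (rule summable_comparison_test'[where N = 0]) (rule norm_sqrt_iter_diff_le[OF assms])
  then have "convergent (\<lambda>n. \<Sum>i<n. sqrt_iter X (Suc i) - sqrt_iter X i)"
    by (simp only: summable_iff_convergent)
  then show ?thesis
    by (simp add: sum_lessThan_telescope del: sqrt_iter.simps(2))
qed

lemma sqrt_iter_invariants:
  assumes "complex_linear X" "selfadjoint X"
  shows "complex_linear (sqrt_iter X n)" "selfadjoint (sqrt_iter X n)"
  by (induction n) (auto intro!: complex_linear_intros selfadjoint_intros assms)

text \<open>Rescaling gives \<open>X\<close> = 1 - A/r of norm at most 1. The limit \<open>Y\<close>
  of the iteration plays the role of 1 - sqrt(A/r), whence the choice of \<open>B\<close>. The
  commutation property is what uniqueness of the root relies on.\<close>

lemma positive_sqrt_exists: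
  fixes A :: "'a::chilbert_space \<Rightarrow>\<^sub>L 'a"
  assumes "positive_op A"
  obtains B where "positive_op B" "B o\<^sub>L B = A"
    "\<And>C. C o\<^sub>L A = A o\<^sub>L C \<Longrightarrow> C o\<^sub>L B = B o\<^sub>L C"
proof -
  have A: "complex_linear A" "selfadjoint A" "\<And>x. 0 \<le> inner (A x) x"
    using assms by (simp_all add: positive_op_iff)
  \<comment> \<open>Adding 1 keeps \<open>r\<close> positive when \<open>A\<close> is 0; being at
    least \<open>norm A\<close>, it puts the quadratic form of \<open>A\<close>/r between 0 and the
    squared norm.\<close>
  define r where "r = norm A + 1"
  have "0 < r"
    by (simp add: r_def add_nonneg_pos)
  define X where "X = id_blinfun - (1/r) *\<^sub>R A"
  have X: "complex_linear X" "selfadjoint X"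
    unfolding X_def by (intro complex_linear_intros selfadjoint_intros A)+
  have "norm X \<le> 1"
  proof (rule norm_selfadjoint_le[OF X(2)])
    fix x
    have "inner (A x) x \<le> norm (A x) * norm x"
      by (rule norm_cauchy_schwarz)
    also have "\<dots> \<le> norm A * norm x * norm x"
      by (intro mult_right_mono norm_blinfun norm_ge_zero)
    also have "\<dots> \<le> r * (norm x)\<^sup>2"
      by (simp add: r_def power2_eq_square algebra_simps)
    finally have "inner (A x) x / r \<le> (norm x)\<^sup>2"
      using \<open>0 < r\<close> by (simp add: field_simps)
    moreover have "0 \<le> inner (A x) x / r"
      using A(3) \<open>0 < r\<close> by simp
    moreover have "inner (X x) x = (norm x)\<^sup>2 - inner (A x) x / r"
      by (simp add: X_def blinfun.bilinear_simps inner_diff_left power2_norm_eq_inner)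
    ultimately show "\<bar>inner (X x) x\<bar> \<le> 1 * (norm x)\<^sup>2"
      by (simp add: abs_le_iff)
  qed simp
  from sqrt_iter_convergent[OF this] obtain Y where Y: "sqrt_iter X \<longlonglongrightarrow> Y"
    by (auto simp: convergent_def)
  have "norm (sqrt_iter X n) \<le> 1" for n
    using norm_sqrt_iter_le[OF \<open>norm X \<le> 1\<close>] scalar_iter_bounds(2) by (rule order_trans)
  \<comment> \<open>This bound makes 1 - \<open>Y\<close>, and hence \<open>B\<close>,
    positive.\<close>
  then have normY: "norm Y \<le> 1"
    by (intro Lim_norm_ubound[OF _ Y]) simp_all
  have "(\<lambda>n. sqrt_iter X (Suc n)) \<longlonglongrightarrow> (1/2) *\<^sub>R (X + (Y o\<^sub>L Y))"
    by (simp only: sqrt_iter.simps) (intro tendsto_intros Y bounded_bilinear.tendsto[OF bounded_bilinear_blinfun_compose])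
  then have "(1/2) *\<^sub>R (X + (Y o\<^sub>L Y)) = Y"
    using LIMSEQ_Suc[OF Y] by (rule LIMSEQ_unique)
  \<comment> \<open>Equivalently, (1 - Y)^2 = 1 - X = A/r.\<close>
  then have YY: "X + (Y o\<^sub>L Y) = 2 *\<^sub>R Y"
    by (metis scaleR_scaleR nonzero_mult_div_cancel_left scaleR_one times_divide_eq_right
        mult.right_neutral zero_neq_numeral)
  define B where "B = sqrt r *\<^sub>R (id_blinfun - Y)"
  show ?thesis
  proof
    have "complex_linear Y" "selfadjoint Y"
      using complex_linear_lim[OF Y] selfadjoint_lim[OF Y] sqrt_iter_invariants[OF X] by auto
    then have "complex_linear B" and "selfadjoint B"
      unfolding B_def by (auto intro!: complex_linear_intros selfadjoint_intros)
    moreover have "0 \<le> inner (B x) x" for x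
    proof -
      have "inner (Y x) x \<le> norm (Y x) * norm x"
        by (rule norm_cauchy_schwarz)
      also have "\<dots> \<le> norm Y * norm x * norm x"
        by (intro mult_right_mono norm_blinfun norm_ge_zero)
      also have "\<dots> \<le> 1 * norm x * norm x"
        by (intro mult_right_mono normY norm_ge_zero)
      finally have "inner (Y x) x \<le> inner x x"
        by (simp add: power2_eq_square flip: power2_norm_eq_inner)
      then show ?thesis
        using \<open>0 < r\<close> by (simp add: B_def blinfun.bilinear_simps inner_diff_left)
    qed
    ultimately show "positive_op B"
      by (simp add: positive_op_iff)
    show "B o\<^sub>L B = A"
    proof (rule blinfun_eqI)
      fix x
      have "X x + Y (Y x) = 2 *\<^sub>R Y x"
        using YY by (metis blinfun.add_left blinfun.scaleR_left blinfun_apply_blinfun_compose)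
      then have "Y (Y x) = 2 *\<^sub>R Y x - X x"
        by (simp add: algebra_simps)
      then have "(B o\<^sub>L B) x = r *\<^sub>R (x - X x)"
        using \<open>0 < r\<close> by (simp add: B_def blinfun.bilinear_simps scaleR_2 flip: scaleR_diff_right)
      also have "\<dots> = A x"
        using \<open>0 < r\<close> by (simp add: X_def blinfun.bilinear_simps)
      finally show "(B o\<^sub>L B) x = A x" .
    qed
    fix C assume "C o\<^sub>L A = A o\<^sub>L C"
    then have "C (A x) = A (C x)" for x
      by (metis blinfun_apply_blinfun_compose)
    then have "C o\<^sub>L X = X o\<^sub>L C"
      by (intro blinfun_eqI) (simp add: X_def blinfun.bilinear_simps)
    then have "C o\<^sub>L sqrt_iter X n = sqrt_iter X n o\<^sub>L C" for n
      by (rule sqrt_iter_commute)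
    moreover have "(\<lambda>n. C o\<^sub>L sqrt_iter X n) \<longlonglongrightarrow> (C o\<^sub>L Y)"
      by (intro bounded_bilinear.tendsto[OF bounded_bilinear_blinfun_compose] tendsto_const Y)
    moreover have "(\<lambda>n. sqrt_iter X n o\<^sub>L C) \<longlonglongrightarrow> (Y o\<^sub>L C)"
      by (intro bounded_bilinear.tendsto[OF bounded_bilinear_blinfun_compose] tendsto_const Y)
    ultimately have "C o\<^sub>L Y = Y o\<^sub>L C"
      by (simp add: LIMSEQ_unique)
    then have "C (Y x) = Y (C x)" for x
      by (metis blinfun_apply_blinfun_compose)
    then show "C o\<^sub>L B = B o\<^sub>L C"
      by (intro blinfun_eqI) (simp add: B_def blinfun.bilinear_simps)
  qed
qed

text \<open>With \<open>R\<close> a positive square root of \<open>A\<close>, the form <Ax, x> is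
  the squared norm of \<open>R x\<close>.\<close>

lemma positive_op_eq_0:
  fixes A :: "'a::chilbert_space \<Rightarrow>\<^sub>L 'a"
  assumes "positive_op A" "inner (A x) x = 0"
  shows "A x = 0"
proof -
  obtain R where R: "positive_op R" "R o\<^sub>L R = A"
    using positive_sqrt_exists[OF assms(1)] by metis
  have "inner (R x) (R x) = inner (A x) x"
    using R(1) unfolding R(2)[symmetric] by (simp add: positive_op_iff selfadjointD)
  then have "R x = 0"
    using assms(2) by simp
  then show ?thesis
    unfolding R(2)[symmetric] by (simp add: blinfun.bilinear_simps)
qed

text \<open>For commuting roots, (B + C)(B - C) = B^2 - C^2 = 0. At \<open>y\<close> = Bx - Cx the
  two nonnegative forms therefore sum to 0, so \<open>B\<close> and \<open>C\<close> both kill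
  \<open>y\<close>, and symmetry gives <y, y> = 0.\<close>

lemma positive_sqrt_unique:
  fixes B C :: "'a::chilbert_space \<Rightarrow>\<^sub>L 'a"
  assumes B: "positive_op B" and C: "positive_op C"
    and eq: "B o\<^sub>L B = C o\<^sub>L C" and comm: "C o\<^sub>L B = B o\<^sub>L C"
  shows "B = C"
proof (rule blinfun_eqI)
  fix x
  define y where "y = B x - C x"
  have "B (B x) = C (C x)" "C (B x) = B (C x)"
    using eq comm by (metis blinfun_apply_blinfun_compose)+
  then have "B y + C y = 0"
    by (simp add: y_def blinfun.bilinear_simps)
  then have "inner (B y) y + inner (C y) y = 0"
    by (simp flip: inner_add_left)
  moreover have "0 \<le> inner (B y) y" "0 \<le> inner (C y) y"
    using B C by (simp_all add: positive_op_iff)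
  ultimately have "B y = 0" "C y = 0"
    by (auto intro!: positive_op_eq_0 B C)
  moreover have "inner y y = inner (B x) y - inner (C x) y"
    by (simp add: y_def inner_diff_left)
  moreover have "inner (B x) y = inner x (B y)" "inner (C x) y = inner x (C y)"
    using B C by (simp_all add: positive_op_iff selfadjointD)
  ultimately have "inner y y = 0"
    by simp
  then show "B x = C x"
    by (simp add: y_def)
qed

section \<open>Square root and absolute value of an operator\<close>

lemma op_sqrt:
  fixes A :: "'a::chilbert_space \<Rightarrow>\<^sub>L 'a"
  assumes "positive_op A"
  shows "positive_op (op_sqrt A)" "op_sqrt A o\<^sub>L op_sqrt A = A"
proof -
  obtain B where B: "positive_op B" "B o\<^sub>L B = A"
    and comm: "\<And>C. C o\<^sub>L A = A o\<^sub>L C \<Longrightarrow> C o\<^sub>L B = B o\<^sub>L C"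
    using positive_sqrt_exists[OF assms] by metis
  have uniq: "C = B" if C: "positive_op C" "C o\<^sub>L C = A" for C
  proof -
    \<comment> \<open>Any root of \<open>A\<close> commutes with \<open>A\<close>, hence with the
      constructed root \<open>B\<close>, so uniqueness among commuting roots suffices.\<close>
    have "C o\<^sub>L A = A o\<^sub>L C"
      unfolding C(2)[symmetric] by (intro blinfun_eqI) simp
    then show ?thesis
      using positive_sqrt_unique[OF B(1) C(1) _ comm] B(2) C(2) by metis
  qed
  have "op_sqrt A = B"
    unfolding op_sqrt_def by (rule the_equality) (use B uniq in blast)+
  with B show "positive_op (op_sqrt A)" "op_sqrt A o\<^sub>L op_sqrt A = A"
    by simp_all
qed

lemma op_abs:
  fixes A :: "'a::chilbert_space \<Rightarrow>\<^sub>L 'a"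
  assumes "complex_linear A"
  shows "positive_op (op_abs A)" "op_abs A o\<^sub>L op_abs A = op_adjoint A o\<^sub>L A"
proof -
  note adj = inner_op_adjoint[OF assms]
  have "complex_linear (op_adjoint A o\<^sub>L A)"
    using complex_linear_adjoint[OF assms adj] assms by (rule complex_linear_intros)
  moreover have "selfadjoint (op_adjoint A o\<^sub>L A)"
    unfolding selfadjoint_def by (simp add: inner_commute[of "op_adjoint A _"] flip: adj)
      (simp add: inner_commute)
  moreover have "0 \<le> inner ((op_adjoint A o\<^sub>L A) x) x" for x
    by (simp add: inner_commute[of _ x] flip: adj)
  ultimately have "positive_op (op_adjoint A o\<^sub>L A)"
    by (simp add: positive_op_iff)
  then show "positive_op (op_abs A)" "op_abs A o\<^sub>L op_abs A = op_adjoint A o\<^sub>L A"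
    unfolding op_abs_def by (rule op_sqrt)+
qed

text \<open>This equality of norms makes the assignment of \<open>A x\<close> to
  \<open>op_abs A x\<close> well defined and isometric, the starting point of the polar
  decomposition.\<close>

lemma norm_op_abs:
  fixes A :: "'a::chilbert_space \<Rightarrow>\<^sub>L 'a"
  assumes "complex_linear A"
  shows "norm (op_abs A x) = norm (A x)"
proof -
  have "inner (op_abs A x) (op_abs A x) = inner x ((op_abs A o\<^sub>L op_abs A) x)"
    using op_abs(1)[OF assms] by (simp add: positive_op_iff selfadjointD)
  also have "\<dots> = inner (A x) (A x)"
    by (simp add: op_abs(2)[OF assms] inner_op_adjoint[OF assms])
  finally show ?thesis
    by (simp add: norm_eq_sqrt_inner)
qed

section \<open>Polar decomposition\<close>

text \<open>
  \<open>polar_rel A B\<close> is the graph of the polar isometry when \<open>norm (A z) = norm (B z)\<close>: split \<open>x\<close>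
  along the closure of the range of \<open>B\<close>, and extend \<open>B z \<mapsto> A z\<close> to the closure by limits.
\<close>

definition polar_rel ::
    "('a::real_inner \<Rightarrow>\<^sub>L 'a) \<Rightarrow> ('a \<Rightarrow>\<^sub>L 'a) \<Rightarrow> 'a \<Rightarrow> 'a \<Rightarrow> 'a \<Rightarrow> bool" where
  "polar_rel A B x v w \<longleftrightarrow> (\<forall>y. inner (x - v) (B y) = 0) \<and>
    (\<exists>z. (\<lambda>n. B (z n)) \<longlonglongrightarrow> v \<and> (\<lambda>n. A (z n)) \<longlonglongrightarrow> w)"

text \<open>Equal norms carry the Cauchy property from the images under \<open>B\<close> to those
  under \<open>A\<close>, so completeness supplies \<open>w\<close>.\<close>

lemma polar_rel_exists:
  fixes A B :: "'a::{real_inner,complete_space} \<Rightarrow>\<^sub>L 'a"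
  assumes "\<And>z. norm (A z) = norm (B z)"
  shows "\<exists>v w. polar_rel A B x v w"
proof -
  obtain z v where z: "(\<lambda>n. B (z n)) \<longlonglongrightarrow> v" and orth: "\<And>y. inner (x - v) (B y) = 0"
    using closed_range_projection[of B x] by metis
  have "dist (A (z m)) (A (z n)) = dist (B (z m)) (B (z n))" for m n
    using assms[of "z m - z n"] by (simp add: dist_norm blinfun.bilinear_simps)
  then have "Cauchy (\<lambda>n. A (z n))"
    using LIMSEQ_imp_Cauchy[OF z] by (simp add: Cauchy_def)
  then obtain w where "(\<lambda>n. A (z n)) \<longlonglongrightarrow> w"
    using Cauchy_convergent[unfolded convergent_def] by blast
  with z orth show ?thesis
    unfolding polar_rel_def by blast
qed

text \<open>Equality of norms and orthogonality pass to the limit; Pythagoras then shows that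
  sending \<open>x\<close> to \<open>w\<close> is a contraction.\<close>

lemma polar_rel_norm:
  fixes A B :: "'a::real_inner \<Rightarrow>\<^sub>L 'a"
  assumes "\<And>z. norm (A z) = norm (B z)" "polar_rel A B x v w"
  shows "norm w = norm v" "inner (x - v) v = 0" "(norm x)\<^sup>2 = (norm (x - v))\<^sup>2 + (norm w)\<^sup>2"
proof -
  obtain z where z: "(\<lambda>n. B (z n)) \<longlonglongrightarrow> v" "(\<lambda>n. A (z n)) \<longlonglongrightarrow> w"
    and orth: "\<And>y. inner (x - v) (B y) = 0"
    using assms(2) by (auto simp: polar_rel_def)
  show 1: "norm w = norm v"
    using LIMSEQ_unique[OF tendsto_norm[OF z(1)]] tendsto_norm[OF z(2)] assms(1) by simp
  have "(\<lambda>n. inner (x - v) (B (z n))) \<longlonglongrightarrow> inner (x - v) v"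
    by (intro tendsto_intros z)
  then show 2: "inner (x - v) v = 0"
    using orth by (simp add: LIMSEQ_const_iff)
  then show "(norm x)\<^sup>2 = (norm (x - v))\<^sup>2 + (norm w)\<^sup>2"
    unfolding 1 power2_norm_eq_inner
    by (simp add: inner_diff_left inner_diff_right inner_commute)
qed

lemma polar_rel_add:
  assumes "polar_rel A B x v w" "polar_rel A B x' v' w'"
  shows "polar_rel A B (x + x') (v + v') (w + w')"
proof -
  obtain z z' where z: "(\<lambda>n. B (z n)) \<longlonglongrightarrow> v" "(\<lambda>n. A (z n)) \<longlonglongrightarrow> w"
    "(\<lambda>n. B (z' n)) \<longlonglongrightarrow> v'" "(\<lambda>n. A (z' n)) \<longlonglongrightarrow> w'"
    using assms by (auto simp: polar_rel_def)
  have "(\<lambda>n. B (z n + z' n)) \<longlonglongrightarrow> v + v'" "(\<lambda>n. A (z n + z' n)) \<longlonglongrightarrow> w + w'"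
    unfolding blinfun.add_right by (intro tendsto_add z)+
  moreover have "inner (x + x' - (v + v')) (B y) = 0" for y
    using assms by (simp add: polar_rel_def inner_add_left inner_diff_left)
  ultimately show ?thesis
    unfolding polar_rel_def by (intro conjI allI exI[of _ "\<lambda>n. z n + z' n"])
qed

lemma polar_rel_scaleC:
  assumes "complex_linear A" "complex_linear B" "polar_rel A B x v w"
  shows "polar_rel A B (c *\<^sub>C x) (c *\<^sub>C v) (c *\<^sub>C w)"
proof -
  obtain z where z: "(\<lambda>n. B (z n)) \<longlonglongrightarrow> v" "(\<lambda>n. A (z n)) \<longlonglongrightarrow> w"
    using assms by (auto simp: polar_rel_def)
  have "(\<lambda>n. B (c *\<^sub>C z n)) \<longlonglongrightarrow> c *\<^sub>C v" "(\<lambda>n. A (c *\<^sub>C z n)) \<longlonglongrightarrow> c *\<^sub>C w"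
    unfolding assms(1,2)[THEN complex_linearD] by (intro tendsto_scaleC z)+
  moreover have "inner (c *\<^sub>C x - c *\<^sub>C v) (B y) = 0" for y
  proof -
    have "inner (c *\<^sub>C x - c *\<^sub>C v) (B y) = inner (x - v) (B (cnj c *\<^sub>C y))"
      by (simp add: complex_linearD[OF assms(2)] inner_scaleC flip: scaleC_diff_right)
    then show ?thesis
      using assms(3) by (simp add: polar_rel_def)
  qed
  ultimately show ?thesis
    unfolding polar_rel_def by (intro conjI allI exI[of _ "\<lambda>n. c *\<^sub>C z n"])
qed

text \<open>By linearity of the relation, two outcomes for \<open>x\<close> differ by an outcome for
  0. There \<open>v - v'\<close> is orthogonal to itself, and \<open>w - w'\<close> has the same
  norm.\<close>

lemma polar_rel_unique:
  fixes A B :: "'a::complex_inner \<Rightarrow>\<^sub>L 'a"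
  assumes "complex_linear A" "complex_linear B" "\<And>z. norm (A z) = norm (B z)"
    and "polar_rel A B x v w" "polar_rel A B x v' w'"
  shows "v = v'" "w = w'"
proof -
  have "polar_rel A B (x + (-1) *\<^sub>C x) (v + (-1) *\<^sub>C v') (w + (-1) *\<^sub>C w')"
    by (intro polar_rel_add polar_rel_scaleC assms)
  moreover have "(-1) *\<^sub>C y = - y" for y :: 'a
    using scaleC_of_real[of "-1" y] by simp
  ultimately have 0: "polar_rel A B 0 (v - v') (w - w')"
    by simp
  have "inner (v - v') (v - v') = 0"
    using polar_rel_norm(2)[OF assms(3) 0]
    by (simp only: diff_0 inner_minus_left neg_equal_0_iff_equal)
  then show "v = v'"
    by simp
  then show "w = w'"
    using polar_rel_norm(1)[OF assms(3) 0] by simp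
qed

text \<open>Uniqueness turns \<open>polar_rel\<close> into a linear map \<open>u\<close>. It
  vanishes at \<open>x\<close> exactly when the projection \<open>P x\<close> does, that is, when
  \<open>x\<close> is orthogonal to the range of \<open>B\<close>; as \<open>B\<close> is
  self-adjoint with the same norms as \<open>A\<close>, this is the null space of
  \<open>A\<close>.\<close>

lemma polar_isometry_exists:
  fixes A B :: "'a::chilbert_space \<Rightarrow>\<^sub>L 'a"
  assumes A: "complex_linear A" and B: "complex_linear B" "selfadjoint B"
    and norm: "\<And>z. norm (A z) = norm (B z)"
  obtains U where "partial_isometry U" "A = U o\<^sub>L B" "null_space U = null_space A"
proof -
  obtain P u where rel: "\<And>x. polar_rel A B x (P x) (u x)"
    using polar_rel_exists[OF norm] by metis
  note uniq = polar_rel_unique[OF A B(1) norm] and nrm = polar_rel_norm[OF norm rel]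
  have uC: "u (c *\<^sub>C x) = c *\<^sub>C u x" for c x
    by (rule uniq(2)[OF rel polar_rel_scaleC[OF A B(1) rel]])
  have "bounded_linear u"
  proof (rule bounded_linear_intro)
    show "u (x + y) = u x + u y" for x y
      by (rule uniq(2)[OF rel polar_rel_add[OF rel rel]])
    show "u (r *\<^sub>R x) = r *\<^sub>R u x" for r x
      using uC[of "complex_of_real r" x] by (simp add: scaleC_of_real)
    have "(norm (u x))\<^sup>2 \<le> (norm x)\<^sup>2" for x
      using nrm(3)[of x] by simp
    then show "norm (u x) \<le> norm x * 1" for x
      by (simp add: power2_le_iff_abs_le)
  qed
  then have U: "blinfun_apply (Blinfun u) = u"
    by (rule bounded_linear_Blinfun_apply)
  \<comment> \<open>A point of the range is its own projection, witnessed by the constant sequence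
    \<open>z\<close>.\<close>
  have "polar_rel A B (B z) (B z) (A z)" for z
    by (auto simp: polar_rel_def)
  then have uB: "u (B z) = A z" for z
    using uniq(2)[OF rel] by blast
  have null_iff: "u x = 0 \<longleftrightarrow> A x = 0" for x
  proof
    assume "u x = 0"
    then have "P x = 0"
      using nrm(1)[of x] by simp
    then have "inner x (B (B x)) = 0"
      using rel[of x] by (simp add: polar_rel_def)
    then have "B x = 0"
      using selfadjointD[OF B(2), of x "B x"] by simp
    then show "A x = 0"
      using norm[of x] by simp
  next
    assume "A x = 0"
    then have "B x = 0"
      using norm[of x] by simp
    then have "polar_rel A B x 0 0"
      unfolding polar_rel_def
      by (auto simp: blinfun.bilinear_simps simp flip: selfadjointD[OF B(2)]
          intro!: exI[of _ "\<lambda>_. 0"])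
    then show "u x = 0"
      using uniq(2)[OF rel] by blast
  qed
  show ?thesis
  proof
    show "null_space (Blinfun u) = null_space A"
      by (simp add: null_space_def U null_iff)
    show "A = Blinfun u o\<^sub>L B"
      by (intro blinfun_eqI) (simp add: U uB)
    have "norm (u x) = norm x" if x: "\<forall>y. u y = 0 \<longrightarrow> cinner x y = 0" for x
    proof -
      \<comment> \<open>The component \<open>x - P x\<close> projects to 0 and so lies in the null
        space of \<open>u\<close>. A vector orthogonal to that null space therefore equals its
        projection, on which \<open>u\<close> preserves the norm.\<close>
      have "polar_rel A B (x - P x) 0 0"
        using rel[of x] unfolding polar_rel_def
        by (auto simp: blinfun.bilinear_simps intro!: exI[of _ "\<lambda>_. 0"])
      then have "u (x - P x) = 0"
        using uniq(2)[OF rel] by blast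
      then have "inner x (x - P x) = 0"
        using x by (simp add: inner_eq_Re_cinner)
      then have "inner (x - P x) (x - P x) = 0"
        using nrm(2)[of x] by (simp add: inner_diff_left inner_diff_right inner_commute)
      then show ?thesis
        using nrm(1)[of x] by simp
    qed
    then show "partial_isometry (Blinfun u)"
      by (simp add: partial_isometry_def complex_linear_def null_space_def U uC)
  qed
qed

text \<open>The description defining \<open>polar_isometry\<close> must be shown to have a unique
  solution. A candidate is fixed on the closure of the range of \<open>op_abs T\<close> by
  continuity, and on the orthogonal complement by its null space.\<close>

lemma complex_linear_polar_isometry:
  fixes T :: "'a::chilbert_space \<Rightarrow>\<^sub>L 'a"
  assumes "complex_linear T"
  shows "complex_linear (polar_isometry T)"
proof -
  note norm = norm_op_abs[OF assms, symmetric]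
  have B: "complex_linear (op_abs T)" "selfadjoint (op_abs T)"
    using op_abs(1)[OF assms] by (simp_all add: positive_op_iff)
  obtain U where U: "partial_isometry U" "T = U o\<^sub>L op_abs T" "null_space U = null_space T"
    using polar_isometry_exists[OF assms B norm] by metis
  have uniq: "U' = U" if U': "T = U' o\<^sub>L op_abs T" "null_space U' = null_space T" for U'
  proof (rule blinfun_eqI)
    fix x
    obtain v w where rel: "polar_rel T (op_abs T) x v w"
      using polar_rel_exists[OF norm] by blast
    have "V x = w" if V: "T = V o\<^sub>L op_abs T" "null_space V = null_space T" for V
    proof -
      obtain z where z: "(\<lambda>n. op_abs T (z n)) \<longlonglongrightarrow> v" "(\<lambda>n. T (z n)) \<longlonglongrightarrow> w"
        using rel by (auto simp: polar_rel_def)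
      have "T (z n) = V (op_abs T (z n))" for n
        using V(1) by (metis blinfun_apply_blinfun_compose)
      moreover have "(\<lambda>n. V (op_abs T (z n))) \<longlonglongrightarrow> V v"
        by (intro tendsto_intros z)
      ultimately have "V v = w"
        using z(2) by (simp add: LIMSEQ_unique)
      have "inner (op_abs T (x - v)) (op_abs T (x - v)) = 0"
        using rel by (simp add: polar_rel_def selfadjointD[OF B(2)])
      then have "T (x - v) = 0"
        using norm[of "x - v"] by simp
      then have "V (x - v) = 0"
        using V(2) by (auto simp: null_space_def)
      with \<open>V v = w\<close> show ?thesis
        by (simp add: blinfun.bilinear_simps)
    qed
    then show "U' x = U x"
      using U U' by metis
  qed
  have "polar_isometry T = U"
    unfolding polar_isometry_def by (rule the_equality) (use U uniq in blast)+
  with U(1) show ?thesis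
    by (simp add: partial_isometry_def)
qed

section \<open>Numerical radius\<close>

text \<open>The values over unit vectors are bounded by the operator norm, so the supremum is
  genuine, and the inserted 0 makes it nonnegative. The real form is dominated by the modulus of the
  complex one, and scaling covers all vectors.\<close>

lemma
  fixes A :: "'a::complex_inner \<Rightarrow>\<^sub>L 'a"
  shows numerical_radius_bound: "\<bar>inner (A x) x\<bar> \<le> numerical_radius A * (norm x)\<^sup>2"
  and numerical_radius_nonneg: "0 \<le> numerical_radius A"
proof -
  let ?S = "insert 0 {cmod (cinner (A x) x) | x. norm x = 1}"
  have "cmod (cinner (A x) x) \<le> norm A" if "norm x = 1" for x
    using cmod_cinner_le[of "A x" x] norm_blinfun[of A x] that by simp
  then have bdd: "bdd_above ?S"
    by (intro bdd_aboveI[of _ "norm A"]) auto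
  show "0 \<le> numerical_radius A"
    unfolding numerical_radius_def using bdd by (intro cSup_upper) auto
  show "\<bar>inner (A x) x\<bar> \<le> numerical_radius A * (norm x)\<^sup>2"
  proof (cases "x = 0")
    case False
    define u where "u = (1 / norm x) *\<^sub>R x"
    have "norm u = 1"
      using False by (simp add: u_def)
    have "\<bar>inner (A u) u\<bar> \<le> cmod (cinner (A u) u)"
      unfolding inner_eq_Re_cinner by (rule abs_Re_le_cmod)
    also have "\<dots> \<le> numerical_radius A"
      unfolding numerical_radius_def using bdd \<open>norm u = 1\<close> by (intro cSup_upper) auto
    finally have "\<bar>inner (A u) u\<bar> * (norm x)\<^sup>2 \<le> numerical_radius A * (norm x)\<^sup>2"
      by (intro mult_right_mono) simp_all
    moreover have "\<bar>inner (A u) u\<bar> * (norm x)\<^sup>2 = \<bar>inner (A x) x\<bar>"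
      using False by (simp add: u_def blinfun.bilinear_simps abs_mult power2_eq_square)
    ultimately show ?thesis
      by simp
  qed (simp add: blinfun.bilinear_simps)
qed

text \<open>\<open>H\<close> stands for A + A*, whose quadratic form is twice the real part of that
  of \<open>A\<close>; the factor 2 leads to the constants 4 and 2 in the final estimate.\<close>

lemma norm_le_twice_numerical_radius:
  fixes A H :: "'a::complex_inner \<Rightarrow>\<^sub>L 'a"
  assumes "selfadjoint H" "\<And>x. inner (H x) x = 2 * inner (A x) x"
  shows "norm H \<le> 2 * numerical_radius A"
proof (rule norm_selfadjoint_le[OF assms(1)])
  show "\<bar>inner (H x) x\<bar> \<le> 2 * numerical_radius A * (norm x)\<^sup>2" for x
    using numerical_radius_bound[of A x] by (simp add: assms(2) abs_mult)
qed (simp add: numerical_radius_nonneg)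

text \<open>The squared norm of \<open>A x\<close> is <x, BAx>, to which Cauchy-Schwarz applies. It
  serves twice: for the mean transform and for a self-adjoint operator paired with itself.\<close>

lemma norm_power2_le_norm_adjoint_compose:
  fixes A :: "'a::real_inner \<Rightarrow>\<^sub>L 'a"
  assumes "\<And>x y. inner (A x) y = inner x (blinfun_apply B y)"
  shows "(norm A)\<^sup>2 \<le> norm (B o\<^sub>L A)"
proof -
  have "norm (A x) \<le> sqrt (norm (B o\<^sub>L A)) * norm x" for x
  proof -
    have "(norm (A x))\<^sup>2 = inner x ((B o\<^sub>L A) x)"
      by (simp add: power2_norm_eq_inner assms)
    also have "\<dots> \<le> norm x * norm ((B o\<^sub>L A) x)"
      by (rule norm_cauchy_schwarz)
    also have "\<dots> \<le> norm x * (norm (B o\<^sub>L A) * norm x)"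
      by (intro mult_left_mono norm_blinfun norm_ge_zero)
    also have "\<dots> = (sqrt (norm (B o\<^sub>L A)) * norm x)\<^sup>2"
      by (simp add: power_mult_distrib power2_eq_square)
    finally show ?thesis
      by (rule power2_le_imp_le) simp
  qed
  then have "norm A \<le> sqrt (norm (B o\<^sub>L A))"
    by (intro norm_blinfun_bound) simp_all
  then show ?thesis
    by (simp add: real_le_rsqrt sqrt_ge_absD)
qed

section \<open>The norm estimate for the mean transform\<close>

theorem theorem3p7:
  fixes T :: "'a::chilbert_space \<Rightarrow>\<^sub>L 'a" and l :: real
  assumes "complex_linear T"
    and "0 \<le> l" and "l \<le> 1"
  shows "norm (mean_transform l T) ^ 4 \<le>
    (norm (Q_op l T))\<^sup>2
    + 4 * (l - l\<^sup>2)\<^sup>2 * (numerical_radius (op_adjoint T o\<^sub>L duggal_transform T))\<^sup>2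
    + 2 * (l - l\<^sup>2) * numerical_radius
        ((Q_op l T o\<^sub>L (op_adjoint T o\<^sub>L duggal_transform T))
          + ((op_adjoint T o\<^sub>L duggal_transform T) o\<^sub>L Q_op l T))"
proof -
  define D where "D = duggal_transform T"
  define S where "S = op_adjoint T o\<^sub>L D"
  \<comment> \<open>This is the adjoint of \<open>S\<close>, so \<open>H\<close> below is S +
    S*.\<close>
  define S' where "S' = op_adjoint D o\<^sub>L T"
  define Q where "Q = Q_op l T"
  define M where "M = mean_transform l T"
  define M' where "M' = l *\<^sub>R op_adjoint T + (1 - l) *\<^sub>R op_adjoint D"
  define W where "W = (Q o\<^sub>L S) + (S o\<^sub>L Q)"
  define c where "c = l - l\<^sup>2"
  define H where "H = S + S'"
  define K where "K = Q + c *\<^sub>R H"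
  define G where "G = (Q o\<^sub>L H) + (H o\<^sub>L Q)"
  \<comment> \<open>Here l in [0, 1] enters, as l^2 <= l.\<close>
  have "0 \<le> c"
    using assms(2,3) by (simp add: c_def power2_eq_square mult_left_le)
  have "complex_linear D"
    unfolding D_def duggal_transform_def
    using op_abs(1)[OF assms(1)] complex_linear_polar_isometry[OF assms(1)]
    by (auto intro: complex_linear_intros simp: positive_op_iff)
  note adjT = inner_op_adjoint[OF assms(1)] and adjD = inner_op_adjoint[OF this]
  have Q: "Q = l\<^sup>2 *\<^sub>R (op_adjoint T o\<^sub>L T) + (1 - l)\<^sup>2 *\<^sub>R (op_adjoint D o\<^sub>L D)"
    unfolding Q_def Q_op_def D_def[symmetric]
    by (simp add: op_abs(2) assms(1) \<open>complex_linear D\<close>)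
  have adjM: "inner (M x) y = inner x (M' y)" for x y
    by (simp add: M_def M'_def mean_transform_def blinfun.bilinear_simps inner_add_left
        inner_add_right adjT adjD flip: D_def)
  \<comment> \<open>The two cross terms of the product carry the factor l(1 - l) =
    \<open>c\<close>.\<close>
  have K: "M' o\<^sub>L M = K"
    unfolding K_def H_def S_def S'_def Q c_def M_def M'_def mean_transform_def D_def[symmetric]
    by (intro blinfun_eqI)
      (simp add: blinfun.bilinear_simps algebra_simps power2_eq_square,
        metis mult_2_right scaleR_left_distrib)
  have adjT': "inner (op_adjoint T x) y = inner x (T y)"
    and adjD': "inner (op_adjoint D x) y = inner x (D y)" for x y
    by (metis adjT inner_commute, metis adjD inner_commute)
  have adjS: "inner (S x) y = inner x (S' y)" "inner (S' x) y = inner x (S y)" for x y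
    by (simp_all add: S_def S'_def adjT adjD adjT' adjD')
  have "selfadjoint H"
    by (simp add: selfadjoint_def H_def blinfun.bilinear_simps inner_add_left inner_add_right adjS)
  have "selfadjoint Q"
    unfolding selfadjoint_def Q
    by (simp add: blinfun.bilinear_simps inner_add_left inner_add_right adjT adjD adjT' adjD')
  have "norm H \<le> 2 * numerical_radius S"
  proof (rule norm_le_twice_numerical_radius[OF \<open>selfadjoint H\<close>])
    show "inner (H x) x = 2 * inner (S x) x" for x
      by (simp add: H_def blinfun.bilinear_simps inner_add_left adjS(2) inner_commute[of x])
  qed
  then have H: "(norm H)\<^sup>2 \<le> 4 * (numerical_radius S)\<^sup>2"
    using power_mono[of "norm H" _ 2] by (fastforce simp: power_mult_distrib)
  have G: "norm G \<le> 2 * numerical_radius W"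
  proof (rule norm_le_twice_numerical_radius)
    show "selfadjoint G"
      using \<open>selfadjoint H\<close> \<open>selfadjoint Q\<close>
      by (simp add: G_def selfadjoint_def blinfun.bilinear_simps inner_add_left inner_add_right)
    fix x
    \<comment> \<open>Passing to adjoints exchanges QS' with SQ and S'Q with QS without changing the
      real form, so QH + HQ has twice the form of \<open>W\<close>.\<close>
    have "inner (Q (S' x)) x = inner (S (Q x)) x" "inner (S' (Q x)) x = inner (Q (S x)) x"
      by (metis adjS(2) selfadjointD[OF \<open>selfadjoint Q\<close>] inner_commute)+
    then show "inner (G x) x = 2 * inner (W x) x"
      by (simp add: G_def H_def W_def blinfun.bilinear_simps inner_add_left)
  qed
  have "selfadjoint K"
    unfolding K_def by (intro selfadjoint_intros \<open>selfadjoint H\<close> \<open>selfadjoint Q\<close>)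
  have KK: "K o\<^sub>L K = (Q o\<^sub>L Q) + c\<^sup>2 *\<^sub>R (H o\<^sub>L H) + c *\<^sub>R G"
    unfolding K_def G_def
    by (intro blinfun_eqI) (simp add: blinfun.bilinear_simps algebra_simps power2_eq_square)
  have "norm M ^ 4 = ((norm M)\<^sup>2)\<^sup>2"
    by simp
  also have "\<dots> \<le> (norm K)\<^sup>2"
    using norm_power2_le_norm_adjoint_compose[OF adjM] unfolding K by (intro power_mono) simp_all
  also have "\<dots> \<le> norm (K o\<^sub>L K)"
    using selfadjointD[OF \<open>selfadjoint K\<close>] by (rule norm_power2_le_norm_adjoint_compose)
  also have "\<dots> \<le> norm (Q o\<^sub>L Q) + norm (c\<^sup>2 *\<^sub>R (H o\<^sub>L H)) + norm (c *\<^sub>R G)"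
    unfolding KK by (intro norm_triangle_le add_right_mono norm_triangle_ineq)
  also have "\<dots> \<le> (norm Q)\<^sup>2 + c\<^sup>2 * (norm H)\<^sup>2 + c * norm G"
    using norm_blinfun_compose[of Q Q] norm_blinfun_compose[of H H] \<open>0 \<le> c\<close>
    by (intro add_mono) (simp_all add: power2_eq_square mult_left_mono)
  also have "\<dots> \<le> (norm Q)\<^sup>2 + c\<^sup>2 * (4 * (numerical_radius S)\<^sup>2) + c * (2 * numerical_radius W)"
    using \<open>0 \<le> c\<close> by (intro add_mono mult_left_mono H G order_refl) simp_all
  finally show ?thesis
    by (simp only: M_def Q_def S_def W_def c_def D_def mult_ac)
qed

end
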